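(* Let $n\ge 1$ and let $g$ be the Semi-Riemannian metric on $GL_n=GL_n(\mathbb{R})$ given by $g_A(V,W)=\mathrm{tr}(A^{-1}VA^{-1}W)$ for $A\in GL_n$, $V,W\in T_A(GL_n)=M_n(\mathbb{R})$. Let $K_1,K_2$ be matrices both in $GL_n^+$ (resp. both in $GL_n^-$). Then $K_1,K_2$ can always be joined by a singly broken geodesic arc in $(GL_n^+,g)$ (resp. $(GL_n^-,g)$).
   Context: $GL_n^+$ and $GL_n^-$ are the connected components of $GL_n(\mathbb{R})$ of matrices with positive, respectively negative, determinant. A geodesic arc joining $A$ and $B$ is any geodesic $\gamma:[0,1]\to GL_n$ of $(GL_n,g)$ with $\gamma(0)=A$, $\gamma(1)=B$ (constant curves are regarded as geodesics). A singly broken geodesic arc joining $K_1$ and $K_2$ is the concatenation of a geodesic arc joining $K_1$ with some point $Z$ and a geodesic arc joining $Z$ with $K_2$ (an unbroken geodesic arc being admitted as a degenerate case). *)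

theory Defs
  imports "HOL-Analysis.Analysis"
begin

(* Levi-Civita connection and geodesics of a semi-Riemannian metric g on an open subset M of a
   Euclidean space E.  Every tangent space is E itself, so g p v w is the product at p of the
   tangent vectors v and w, and E serves as a single global chart. *)

(* Christoffel symbols of the first kind: the Koszul formula for the coordinate (constant) vector
   fields v, w, z, whose Lie brackets vanish. *)
definition christoffel_first ::
    "('a::euclidean_space \<Rightarrow> 'a \<Rightarrow> 'a \<Rightarrow> real) \<Rightarrow> 'a \<Rightarrow> 'a \<Rightarrow> 'a \<Rightarrow> 'a \<Rightarrow> real" where
  "christoffel_first g p v w z =
     (frechet_derivative (\<lambda>q. g q w z) (at p) v
    + frechet_derivative (\<lambda>q. g q v z) (at p) w
    - frechet_derivative (\<lambda>q. g q v w) (at p) z) / 2"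

(* christoffel g p v w is the covariant derivative at p of the constant field w in the direction v.
   The description is proper wherever g p is a nondegenerate bilinear form and g is differentiable
   at p. *)
definition christoffel ::
    "('a::euclidean_space \<Rightarrow> 'a \<Rightarrow> 'a \<Rightarrow> real) \<Rightarrow> 'a \<Rightarrow> 'a \<Rightarrow> 'a \<Rightarrow> 'a" where
  "christoffel g p v w = (THE u. \<forall>z. g p u z = christoffel_first g p v w z)"

(* A smooth curve \<gamma> : [0,1] \<rightarrow> M from a to b whose velocity is parallel along \<gamma>.
   D k is the k-th derivative of \<gamma>, one-sided at the end points 0 and 1.  The velocity may vanish,
   so constant curves qualify. *)
definition geodesic_arc ::
    "'a set \<Rightarrow> ('a::euclidean_space \<Rightarrow> 'a \<Rightarrow> 'a \<Rightarrow> real) \<Rightarrow> 'a \<Rightarrow> 'a \<Rightarrow> (real \<Rightarrow> 'a) \<Rightarrow> bool" where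
  "geodesic_arc M g a b \<gamma> \<longleftrightarrow>
     \<gamma> ` {0..1} \<subseteq> M \<and> \<gamma> 0 = a \<and> \<gamma> 1 = b \<and>
     (\<exists>D :: nat \<Rightarrow> real \<Rightarrow> 'a.
        D 0 = \<gamma> \<and>
        (\<forall>k. \<forall>t\<in>{0..1}. (D k has_vector_derivative D (Suc k) t) (at t within {0..1})) \<and>
        (\<forall>t\<in>{0..1}. D 2 t + christoffel g (\<gamma> t) (D 1 t) (D 1 t) = 0))"

(* An unbroken geodesic arc is included: take z to be its midpoint. *)
definition singly_broken_geodesic_arc ::
    "'a set \<Rightarrow> ('a::euclidean_space \<Rightarrow> 'a \<Rightarrow> 'a \<Rightarrow> real) \<Rightarrow> 'a \<Rightarrow> 'a \<Rightarrow> (real \<Rightarrow> 'a) \<Rightarrow> bool" where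
  "singly_broken_geodesic_arc M g a b \<gamma> \<longleftrightarrow>
     (\<exists>z \<gamma>1 \<gamma>2. geodesic_arc M g a z \<gamma>1 \<and> geodesic_arc M g z b \<gamma>2 \<and> \<gamma> = \<gamma>1 +++ \<gamma>2)"

definition GL_pos :: "(real ^ 'n ^ 'n) set" where
  "GL_pos = {A. det A > 0}"

definition GL_neg :: "(real ^ 'n ^ 'n) set" where
  "GL_neg = {A. det A < 0}"

definition GL_metric :: "real ^ 'n ^ 'n \<Rightarrow> real ^ 'n ^ 'n \<Rightarrow> real ^ 'n ^ 'n \<Rightarrow> real" where
  "GL_metric A V W = trace (matrix_inv A ** V ** matrix_inv A ** W)"

end

theory Submission
  imports Defs
begin

text \<open>The metric is bi-invariant, so the curves \<open>K exp(tX)\<close> are geodesics, and it suffices to write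
  \<open>K1\<^sup>-\<^sup>1 K2\<close>, which has positive determinant, as \<open>exp X exp Y\<close>.  By polar decomposition it is a
  special orthogonal matrix times a positive definite one.  A matrix \<open>A\<close> is an exponential as soon as
  the segment from \<open>1\<close> to \<open>A\<close> consists of invertible matrices; this covers positive definite matrices
  and orthogonal matrices without eigenvalue \<open>- 1\<close>.  For a special orthogonal \<open>Q\<close> the eigenspace of
  \<open>- 1\<close> has even dimension, so \<open>Q\<close> is a product of two commuting orthogonal matrices without
  eigenvalue \<open>- 1\<close>, one of them a quarter turn of that eigenspace.\<close>

section \<open>Inverses and logarithms in Banach algebras\<close>

text \<open>The difference factors as \<open>R x - r = R x * (a - c x) * r\<close>. Once
  \<open>norm (a - c x) * norm r\<close> is below 1/2, this identity itself bounds
  \<open>norm (R x)\<close> by \<open>2 * norm r\<close>, and reinserting that bound gives a null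
  majorant.\<close>

lemma tendsto_algebra_inverse:
  fixes c R :: "'b \<Rightarrow> 'a::real_normed_algebra_1"
  assumes c: "(c \<longlongrightarrow> a) F" and a: "a * r = 1" and R: "\<forall>\<^sub>F x in F. R x * c x = 1"
  shows "(R \<longlongrightarrow> r) F"
proof -
  define e where "e x = norm (a - c x) * norm r" for x
  have e0: "(e \<longlongrightarrow> 0) F"
    unfolding e_def by (auto intro!: tendsto_eq_intros c)
  have ev: "\<forall>\<^sub>F x in F. norm (R x - r) \<le> 2 * norm r * e x"
    using R order_tendstoD(2)[OF e0, of "1/2", simplified]
  proof eventually_elim
    case (elim x)
    have "R x - r = R x * (a * r) - (R x * c x) * r" using elim a by simp
    also have "\<dots> = R x * ((a - c x) * r)" by (simp add: algebra_simps)
    finally have "norm (R x - r) \<le> norm (R x) * norm ((a - c x) * r)"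
      by (metis norm_mult_ineq)
    also have "\<dots> \<le> norm (R x) * e x"
      unfolding e_def by (intro mult_left_mono norm_mult_ineq) auto
    finally have d: "norm (R x - r) \<le> norm (R x) * e x" .
    have "norm (R x) * e x \<le> norm (R x) * (1/2)"
      using elim by (intro mult_left_mono) auto
    moreover have "norm (R x) \<le> norm (R x - r) + norm r"
      using norm_triangle_ineq[of "R x - r" r] by simp
    ultimately have "norm (R x) \<le> 2 * norm r" using d by linarith
    then have "norm (R x) * e x \<le> 2 * norm r * e x"
      by (intro mult_right_mono) (auto simp: e_def)
    with d show ?case by linarith
  qed
  have "((\<lambda>x. R x - r) \<longlongrightarrow> 0) F"
    by (rule Lim_null_comparison[OF ev]) (auto intro!: tendsto_eq_intros e0)
  then show ?thesis by (simp add: LIM_zero_iff)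
qed

text \<open>The remainder is exactly \<open>- (R q - R p) * (q - p) * R p\<close>; divided by
  \<open>norm (q - p)\<close> it is controlled by \<open>norm (R q - R p)\<close>, which tends to
  0.\<close>

lemma has_derivative_algebra_inverse:
  fixes R :: "'a \<Rightarrow> 'a::real_normed_algebra_1"
  assumes R: "\<forall>\<^sub>F q in at p. R q * q = 1" and p: "p * R p = 1"
  shows "(R has_derivative (\<lambda>h. - (R p * h * R p))) (at p)"
proof -
  let ?r = "R p"
  have lim: "(R \<longlongrightarrow> ?r) (at p)"
    by (rule tendsto_algebra_inverse[OF tendsto_ident_at p R])
  have ev: "\<forall>\<^sub>F q in at p. norm (norm ((R q - ?r) - - (?r * (q - p) * ?r)) / norm (q - p)) \<le> norm (R q - ?r) * norm ?r"
    using R eventually_neq_at_within[of p]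
  proof eventually_elim
    case (elim q)
    have "(R q - ?r) - - (?r * (q - p) * ?r)
        = R q * (p * ?r) - (R q * q) * ?r + ?r * q * ?r - ?r * (p * ?r)"
      using elim p by (simp add: algebra_simps)
    also have "\<dots> = - ((R q - ?r) * ((q - p) * ?r))"
      by (simp add: algebra_simps)
    finally have "norm ((R q - ?r) - - (?r * (q - p) * ?r)) \<le> norm (R q - ?r) * norm ((q - p) * ?r)"
      by (metis norm_mult_ineq norm_minus_cancel)
    also have "\<dots> \<le> norm (R q - ?r) * (norm (q - p) * norm ?r)"
      by (intro mult_left_mono norm_mult_ineq) auto
    finally show ?case using elim by (simp add: field_simps)
  qed
  have "bounded_linear (\<lambda>h. - (?r * h * ?r))"
    by (intro bounded_linear_minus bounded_linear_mult_const bounded_linear_const_mult bounded_linear_ident)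
  then show ?thesis
    unfolding has_derivative_iff_norm
    by (intro conjI Lim_null_comparison[OF ev]) (auto intro!: tendsto_eq_intros lim)
qed

text \<open>Beyond the linear term the series is dominated by the tail of the real exponential at
  \<open>norm h\<close>, hence by \<open>(norm h)\<^sup>2\<close>.\<close>

lemma has_derivative_exp_0:
  "((exp :: 'a \<Rightarrow> 'a::{real_normed_algebra_1,banach}) has_derivative (\<lambda>h. h)) (at 0)"
proof -
  have b: "norm (exp h - 1 - h) \<le> (norm h)\<^sup>2" if "norm h \<le> 1" for h :: 'a
  proof -
    let ?f = "\<lambda>n. inverse (fact (n + 2)) *\<^sub>R (h ^ (n + 2))"
    let ?g = "\<lambda>n. inverse (fact (n + 2)) *\<^sub>R (norm h ^ (n + 2))"
    have g: "summable ?g"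
      by (rule summable_exp_generic[THEN summable_ignore_initial_segment])
    have le: "norm (?f n) \<le> ?g n" for n
      by (simp del: fact_Suc power_Suc add: mult_left_mono norm_power_ineq)
    have "norm (exp h - 1 - h) = norm (suminf ?f)"
      by (subst exp_first_two_terms) (simp del: fact_Suc power_Suc)
    also have "\<dots> \<le> suminf ?g"
      by (rule norm_suminf_le[OF le g])
    also have "\<dots> = exp (norm h) - 1 - norm h"
      by (subst exp_first_two_terms) (simp del: fact_Suc power_Suc)
    also have "\<dots> \<le> (norm h)\<^sup>2" using exp_bound[of "norm h"] that by simp
    finally show ?thesis .
  qed
  have ev: "\<forall>\<^sub>F h in at (0::'a). norm (norm ((exp h - exp 0) - (h - 0)) / norm (h - 0)) \<le> norm h"
    unfolding eventually_at
  proof (intro exI[of _ 1] conjI ballI impI)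
    fix h :: 'a assume "h \<noteq> 0 \<and> dist h 0 < 1"
    then show "norm (norm ((exp h - exp 0) - (h - 0)) / norm (h - 0)) \<le> norm h"
      using b[of h] by (simp add: divide_le_eq power2_eq_square)
  qed simp
  show ?thesis
    unfolding has_derivative_iff_norm
    by (intro conjI Lim_null_comparison[OF ev] bounded_linear_ident) (auto intro!: tendsto_eq_intros)
qed

text \<open>The logarithm is the integral of the logarithmic derivative of the segment from
  \<open>1\<close> to \<open>1 + B\<close>, whose values commute with each other.\<close>

context
  fixes B :: "'a::{real_normed_algebra_1,banach}" and R :: "real \<Rightarrow> 'a"
  assumes left: "\<And>s. s \<in> {0..1} \<Longrightarrow> R s * (1 + s *\<^sub>R B) = 1"
    and right: "\<And>s. s \<in> {0..1} \<Longrightarrow> (1 + s *\<^sub>R B) * R s = 1"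
begin

lemma segment_inverse_continuous: "continuous_on {0..1} R"
  unfolding continuous_on_def
proof
  fix s :: real assume s: "s \<in> {0..1}"
  show "(R \<longlongrightarrow> R s) (at s within {0..1})"
    by (rule tendsto_algebra_inverse[where c="\<lambda>t. 1 + t *\<^sub>R B", OF _ right[OF s]])
       (auto intro!: tendsto_eq_intros always_eventually left simp: eventually_at_filter)
qed

lemma segment_integrand_integrable:
  "s \<le> 1 \<Longrightarrow> (\<lambda>s. B * R s) integrable_on {0..s}"
  by (intro integrable_continuous_real continuous_intros continuous_on_subset[OF segment_inverse_continuous]) auto

lemma segment_inverse_commute:
  assumes "s \<in> {0..1}" "C * B = B * C"
  shows "C * R s = R s * C"
proof -
  have "C * (1 + s *\<^sub>R B) = (1 + s *\<^sub>R B) * C" using assms(2) by (simp add: algebra_simps)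
  then have "R s * (C * (1 + s *\<^sub>R B)) * R s = R s * ((1 + s *\<^sub>R B) * C) * R s" by simp
  then show ?thesis using left[OF assms(1)] right[OF assms(1)] by (metis mult.assoc mult_1 mult_1_right)
qed

text \<open>Multiplication by \<open>C\<close> on either side is bounded linear and passes through
  the integral. Taking \<open>C = B\<close> first and then such an integral as \<open>C\<close>
  shows that the integrals up to different end points commute.\<close>

lemma segment_integral_commute:
  assumes "s \<le> 1" "C * B = B * C"
  shows "C * integral {0..s} (\<lambda>s. B * R s) = integral {0..s} (\<lambda>s. B * R s) * C"
proof -
  have "C * (B * R t) = B * R t * C" if "t \<in> {0..s}" for t
    using segment_inverse_commute[of t C] assms that by (auto simp: mult.assoc) (metis mult.assoc)
  then have "integral {0..s} (\<lambda>t. C * (B * R t)) = integral {0..s} (\<lambda>t. B * R t * C)"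
    by (intro integral_cong)
  then show ?thesis
    using integral_linear[OF segment_integrand_integrable[OF assms(1)] bounded_linear_mult_right[of C]]
      integral_linear[OF segment_integrand_integrable[OF assms(1)] bounded_linear_mult_left[of C]]
    by (simp add: o_def)
qed

text \<open>\<open>exp (- L t) * (1 + t *\<^sub>R B)\<close> has derivative zero, since the
  derivative \<open>B * R t\<close> of \<open>L\<close> is the logarithmic derivative of the
  segment; its value at 0 is 1.\<close>

lemma exp_segment_integral: "exp (integral {0..1} (\<lambda>s. B * R s)) = 1 + B"
proof -
  define L where "L t = integral {0..t} (\<lambda>s. B * R s)" for t
  define F where "F t = exp (- L t) * (1 + t *\<^sub>R B)" for t
  have dL: "(L has_vector_derivative B * R t) (at t within {0..1})" if "t \<in> {0..1}" for t
    unfolding L_def using that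
    by (intro integral_has_vector_derivative continuous_intros segment_inverse_continuous)
  have LB: "B * L t = L t * B" if "t \<in> {0..1}" for t
    unfolding L_def using that by (intro segment_integral_commute) auto
  have LL: "L s * L t = L t * L s" if "s \<in> {0..1}" "t \<in> {0..1}" for s t
    unfolding L_def[of t] using that LB[of s] L_def by (intro segment_integral_commute) auto
  have "(F has_vector_derivative 0) (at t within {0..1})" if t: "t \<in> {0..1}" for t
  proof -
    \<comment> \<open>The values of \<open>L\<close> commute, so \<open>exp (- L s)\<close> splits
      off the constant factor \<open>exp (- L t)\<close>. The other exponent vanishes at
      \<open>s = t\<close>, where the derivative of \<open>exp\<close> is known.\<close>
    let ?G = "\<lambda>s. exp (- L t) * exp (- (L s - L t)) * (1 + s *\<^sub>R B)"
    have exp0: "((exp :: 'a \<Rightarrow> 'a) has_derivative (\<lambda>h. h)) (at (- (L t - L t)))"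
      using has_derivative_exp_0 by simp
    have "((\<lambda>s. - (L s - L t)) has_derivative (\<lambda>h. - (h *\<^sub>R (B * R t) - 0))) (at t within {0..1})"
      using dL[OF t] unfolding has_vector_derivative_def
      by (intro derivative_intros)
    from has_derivative_compose[OF this exp0]
    have d: "((\<lambda>s. exp (- (L s - L t))) has_vector_derivative (- (B * R t))) (at t within {0..1})"
      unfolding has_vector_derivative_def by simp
    have "(?G has_vector_derivative
        (exp (- L t) * exp (- (L t - L t))) * (0 + 1 *\<^sub>R B) + (exp (- L t) * (- (B * R t))) * (1 + t *\<^sub>R B)) (at t within {0..1})"
      by (intro has_vector_derivative_mult has_vector_derivative_mult_right d derivative_intros)
         (auto intro!: derivative_eq_intros)
    moreover have "(exp (- L t) * (- (B * R t))) * (1 + t *\<^sub>R B) = - (exp (- L t) * B)"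
      using left[OF t] by (simp add: mult.assoc)
    ultimately have "(?G has_vector_derivative 0) (at t within {0..1})" by simp
    then show ?thesis
    proof (rule has_vector_derivative_transform[OF t, rotated])
      fix s :: real assume s: "s \<in> {0..1}"
      have "exp (- L t + - (L s - L t)) = exp (- L t) * exp (- (L s - L t))"
        using LL[OF s t] by (intro exp_add_commuting) (simp add: algebra_simps)
      then show "F s = ?G s" unfolding F_def by simp
    qed
  qed
  then obtain c where "\<And>t. t \<in> {0..1} \<Longrightarrow> F t = c"
    using has_vector_derivative_zero_constant[of "{0..1::real}" F] by auto
  then have "F 1 = F 0" by simp
  then have "exp (- L 1) * (1 + B) = 1" by (simp add: F_def L_def)
  then have "exp (L 1) * (exp (- L 1) * (1 + B)) = exp (L 1)" by simp
  then show ?thesis using exp_minus_inverse[of "L 1"] by (simp add: mult.assoc[symmetric] L_def)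
qed

end

section \<open>The Banach algebra of square matrices\<close>

text \<open>Multiplication on \<^typ>\<open>real^'n^'n\<close> is componentwise, so the Banach algebra of matrices
  needs a type of its own.\<close>

typedef 'n sqmat = "UNIV :: (real^'n::finite^'n) set"
  morphisms mat_of of_mat ..

lemmas [simp] = of_mat_inverse[OF UNIV_I] mat_of_inverse
lemmas sqmat_eq_iff = mat_of_inject[symmetric]

instantiation sqmat :: (finite) real_algebra_1
begin

definition "0 = of_mat 0"
definition "1 = of_mat (mat 1)"
definition "A + B = of_mat (mat_of A + mat_of B)"
definition "A - B = of_mat (mat_of A - mat_of B)"
definition "- A = of_mat (- mat_of A)"
definition "A * B = of_mat (mat_of A ** mat_of B)"
definition "c *\<^sub>R A = of_mat (c *\<^sub>R mat_of A)"

lemma mat_of_simps [simp]: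
  "mat_of 0 = 0" "mat_of 1 = mat 1" "mat_of (A + B) = mat_of A + mat_of B"
  "mat_of (A - B) = mat_of A - mat_of B" "mat_of (- A) = - mat_of A"
  "mat_of (A * B) = mat_of A ** mat_of B" "mat_of (c *\<^sub>R A) = c *\<^sub>R mat_of A"
  by (simp_all add: zero_sqmat_def one_sqmat_def plus_sqmat_def minus_sqmat_def uminus_sqmat_def
      times_sqmat_def scaleR_sqmat_def)

instance
proof
  fix A B C :: "'a sqmat" and a b :: real
  show "A * B * C = A * (B * C)"
    by (simp add: sqmat_eq_iff matrix_mul_assoc)
  show "(A + B) * C = A * C + B * C"
    by (simp add: sqmat_eq_iff matrix_matrix_mult_def vec_eq_iff sum.distrib algebra_simps)
  show "A * (B + C) = A * B + A * C"
    by (simp add: sqmat_eq_iff matrix_add_ldistrib)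
  show "a *\<^sub>R A * B = a *\<^sub>R (A * B)" "A * a *\<^sub>R B = a *\<^sub>R (A * B)"
    by (simp_all add: sqmat_eq_iff scalar_matrix_assoc matrix_scalar_ac)
  show "(0::'a sqmat) \<noteq> 1"
    by (simp add: sqmat_eq_iff mat_def vec_eq_iff)
qed (simp_all add: sqmat_eq_iff algebra_simps)

end

instantiation sqmat :: (finite) real_normed_algebra_1
begin

text \<open>The operator norm, because the class demands \<open>norm 1 = 1\<close>, which the
  Euclidean norm of the entries violates in dimension above one.\<close>

definition "norm A = onorm ((*v) (mat_of A))"
definition "sgn (A :: 'a sqmat) = A /\<^sub>R norm A"
definition "dist (A :: 'a sqmat) B = norm (A - B)"
definition "(uniformity :: ('a sqmat \<times> 'a sqmat) filter) = (INF e\<in>{0<..}. principal {(x, y). dist x y < e})"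
definition "open (U :: 'a sqmat set) = (\<forall>x\<in>U. \<forall>\<^sub>F (x', y) in uniformity. x' = x \<longrightarrow> y \<in> U)"

instance
proof
  fix A B C :: "'a sqmat" and a b :: real
  have bl: "bounded_linear ((*v) M)" for M :: "real^'a^'a" by (rule matrix_vector_mul_bounded_linear)
  show "norm (1::'a sqmat) = 1"
    using onorm_id[where 'a="real^'a"] by (simp add: norm_sqmat_def id_def matrix_vector_mul_lid[abs_def])
  show "norm (A * B) \<le> norm A * norm B"
    using onorm_compose[OF bl bl, of "mat_of A" "mat_of B"]
    by (simp add: norm_sqmat_def o_def matrix_vector_mul_assoc)
  show "norm (A + B) \<le> norm A + norm B"
    using onorm_triangle[OF bl bl, of "mat_of A" "mat_of B"]
    by (simp add: norm_sqmat_def matrix_vector_mult_add_rdistrib[abs_def])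
  show "norm (a *\<^sub>R A) = \<bar>a\<bar> * norm A"
    using onorm_scaleR[OF bl, of a "mat_of A"]
    by (simp add: norm_sqmat_def scaleR_matrix_vector_assoc)
  show "norm A = 0 \<longleftrightarrow> A = 0"
    by (simp add: norm_sqmat_def onorm_eq_0[OF bl] sqmat_eq_iff)
       (metis matrix_eq matrix_vector_mult_0)
qed (simp_all add: sgn_sqmat_def dist_sqmat_def uniformity_sqmat_def open_sqmat_def)

end

text \<open>The operator norm bounds every entry. Together with the converse map this identifies the
  two topologies, so completeness and derivatives can be transferred.\<close>

lemma bounded_linear_mat_of: "bounded_linear (mat_of :: 'n::finite sqmat \<Rightarrow> _)"
proof
  have "norm (mat_of A) \<le> norm A * (real CARD('n) * real CARD('n))" for A :: "'n sqmat"
  proof -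
    have "norm (mat_of A $ i) \<le> real CARD('n) * norm A" for i
    proof -
      have "(\<Sum>j\<in>UNIV. \<bar>mat_of A $ i $ j\<bar>) \<le> (\<Sum>j\<in>(UNIV::'n set). norm A)"
        by (intro sum_mono) (simp add: norm_sqmat_def matrix_component_le_onorm)
      with norm_le_l1_cart[of "mat_of A $ i"] show ?thesis by simp
    qed
    then have "(\<Sum>i\<in>UNIV. norm (mat_of A $ i)) \<le> (\<Sum>i\<in>(UNIV::'n set). real CARD('n) * norm A)"
      by (intro sum_mono)
    moreover have "norm (mat_of A) \<le> (\<Sum>i\<in>UNIV. norm (mat_of A $ i))"
      unfolding norm_vec_def by (intro L2_set_le_sum) auto
    ultimately show ?thesis by (simp add: algebra_simps)
  qed
  then show "\<exists>K. \<forall>A::'n sqmat. norm (mat_of A) \<le> norm A * K" by blast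
qed simp_all

lemma bounded_linear_of_mat: "bounded_linear (of_mat :: _ \<Rightarrow> 'n::finite sqmat)"
  by (intro linear_conv_bounded_linear[THEN iffD1] linearI) (simp_all add: sqmat_eq_iff)

instance sqmat :: (finite) banach
proof
  fix X :: "nat \<Rightarrow> 'a sqmat" assume "Cauchy X"
  then have "convergent (\<lambda>n. mat_of (X n))"
    by (intro Cauchy_convergent bounded_linear.Cauchy[OF bounded_linear_mat_of])
  then obtain L where "(\<lambda>n. mat_of (X n)) \<longlonglongrightarrow> L" by (auto simp: convergent_def)
  from bounded_linear.tendsto[OF bounded_linear_of_mat this]
  show "convergent X" by (auto simp: convergent_def)
qed

section \<open>Transposition on the matrix algebra\<close>

definition adj :: "'n::finite sqmat \<Rightarrow> 'n sqmat" where
  "adj A = of_mat (transpose (mat_of A))"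

lemma adj_simps [simp]:
  "adj 0 = 0" "adj 1 = 1" "adj (A + B) = adj A + adj B" "adj (A - B) = adj A - adj B"
  "adj (- A) = - adj A" "adj (A * B) = adj B * adj A" "adj (c *\<^sub>R A) = c *\<^sub>R adj A" "adj (adj A) = A"
  by (simp_all add: adj_def sqmat_eq_iff matrix_transpose_mul transpose_scalar)
     (simp_all add: transpose_def vec_eq_iff)

lemma mat_of_adj [simp]: "mat_of (adj A) = transpose (mat_of A)"
  by (simp add: adj_def)

lemma bounded_linear_adj: "bounded_linear (adj :: 'n::finite sqmat \<Rightarrow> _)"
proof -
  have "linear (transpose :: real^'n^'n \<Rightarrow> _)"
    by (intro linearI) (simp_all add: transpose_def vec_eq_iff)
  then have "bounded_linear (transpose :: real^'n^'n \<Rightarrow> _)"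
    by (simp add: linear_conv_bounded_linear)
  from bounded_linear_compose[OF bounded_linear_of_mat bounded_linear_compose[OF this bounded_linear_mat_of]]
  show ?thesis by (simp add: adj_def[abs_def])
qed

lemma adj_exp: "adj (exp A) = exp (adj A)"
proof -
  have pow: "adj (A ^ n) = adj A ^ n" for n
    by (induction n) (simp_all add: power_commutes)
  have "adj (exp A) = (\<Sum>n. adj (A ^ n /\<^sub>R fact n))"
    unfolding exp_def by (rule bounded_linear.suminf[OF bounded_linear_adj summable_exp_generic])
  then show ?thesis by (simp add: exp_def pow)
qed

section \<open>Matrix logarithms and the polar decomposition\<close>

definition app :: "'n::finite sqmat \<Rightarrow> real^'n \<Rightarrow> real^'n" where
  "app A v = mat_of A *v v"

definition sdet :: "'n::finite sqmat \<Rightarrow> real" where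
  "sdet A = det (mat_of A)"

definition sinv :: "'n::finite sqmat \<Rightarrow> 'n sqmat" where
  "sinv A = of_mat (matrix_inv (mat_of A))"

lemma sqmat_eqI: "(\<And>v. app A v = app B v) \<Longrightarrow> A = B"
  by (simp add: sqmat_eq_iff matrix_eq app_def)

lemma app_simps [simp]:
  "app 0 v = 0" "app 1 v = v" "app (A + B) v = app A v + app B v" "app (A - B) v = app A v - app B v"
  "app (A * B) v = app A (app B v)" "app (c *\<^sub>R A) v = c *\<^sub>R app A v"
  by (simp_all add: app_def matrix_vector_mult_add_rdistrib matrix_vector_mult_diff_rdistrib
      matrix_vector_mul_assoc scaleR_matrix_vector_assoc)

lemma app_minus [simp]: "app (- A) v = - app A v"
  using app_simps(4)[of 0 A v] by simp

lemma linear_app: "linear (app A)"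
  unfolding app_def[abs_def] by (rule matrix_vector_mul_linear)

lemmas app_linear_simps [simp] = linear_0[OF linear_app] linear_add[OF linear_app]
  linear_diff[OF linear_app] linear_neg[OF linear_app] linear_cmul[OF linear_app]

lemma sdet_1 [simp]: "sdet 1 = 1"
  by (simp add: sdet_def)

lemma sdet_mult [simp]: "sdet (A * B) = sdet A * sdet B"
  by (simp add: sdet_def det_mul)

lemma sdet_adj [simp]: "sdet (adj A) = sdet A"
  by (simp add: sdet_def)

lemma inner_app_adj: "app (adj A) v \<bullet> w = v \<bullet> app A w"
  by (simp add: app_def dot_lmul_matrix)

lemma sdet_nonzeroI:
  assumes "\<And>v. app A v = 0 \<Longrightarrow> v = 0"
  shows "sdet A \<noteq> 0"
  using assms matrix_left_invertible_ker[of "mat_of A"]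
  by (auto simp: sdet_def app_def simp flip: invertible_det_nz invertible_left_inverse)

lemma sinv_mult:
  assumes "sdet A \<noteq> 0"
  shows "sinv A * A = 1" "A * sinv A = 1"
proof -
  have "invertible (mat_of A)" using assms by (simp add: invertible_det_nz sdet_def)
  then have "\<exists>B. mat_of A ** B = mat 1 \<and> B ** mat_of A = mat 1"
    by (auto simp: invertible_def)
  from someI_ex[OF this] show "sinv A * A = 1" "A * sinv A = 1"
    unfolding sinv_def sqmat_eq_iff matrix_inv_def by simp_all
qed

lemma sqmat_left_right_inverse: "A * B = 1 \<longleftrightarrow> B * A = (1 :: 'n::finite sqmat)"
  using matrix_left_right_inverse[of "mat_of A" "mat_of B"] by (simp add: sqmat_eq_iff)

text \<open>\<open>exp X\<close> is the square of the invertible matrix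
  \<open>exp ((1/2) *\<^sub>R X)\<close>.\<close>

lemma sdet_exp_pos: "0 < sdet (exp X)"
proof -
  let ?E = "exp ((1/2) *\<^sub>R X)"
  have "exp X = ?E * ?E"
    by (subst exp_add_commuting[symmetric]) (simp_all flip: scaleR_add_left)
  then have "sdet (exp X) = (sdet ?E)\<^sup>2"
    by (metis sdet_mult power2_eq_square)
  moreover have "sdet ?E * sdet (exp (- ((1/2) *\<^sub>R X))) = 1"
    by (metis sdet_mult sdet_1 exp_minus_inverse)
  ultimately show ?thesis by auto
qed

text \<open>Equivalently, \<open>A\<close> has no real eigenvalue \<le> 0.\<close>

definition segment_invertible :: "'n::finite sqmat \<Rightarrow> bool" where
  "segment_invertible A \<longleftrightarrow> (\<forall>s\<in>{0..1}. sdet (1 + s *\<^sub>R (A - 1)) \<noteq> 0)"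

text \<open>For matrices with invertible segment this is the principal logarithm.\<close>

definition logm :: "'n::finite sqmat \<Rightarrow> 'n sqmat" where
  "logm A = integral {0..1} (\<lambda>s. (A - 1) * sinv (1 + s *\<^sub>R (A - 1)))"

context
  fixes A :: "'n::finite sqmat"
  assumes A: "segment_invertible A"
begin

lemma segment_sinv:
  assumes "s \<in> {0..1}"
  shows "sinv (1 + s *\<^sub>R (A - 1)) * (1 + s *\<^sub>R (A - 1)) = 1"
    "(1 + s *\<^sub>R (A - 1)) * sinv (1 + s *\<^sub>R (A - 1)) = 1"
  using A assms sinv_mult unfolding segment_invertible_def by blast+

lemma exp_logm: "exp (logm A) = A"
  unfolding logm_def using exp_segment_integral[OF segment_sinv] by simp

lemma logm_commute:
  assumes "C * A = A * C"
  shows "C * logm A = logm A * C"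
  unfolding logm_def using assms
  by (intro segment_integral_commute segment_sinv) (simp_all add: algebra_simps)

text \<open>Transposition fixes the points of the segment, hence their inverses, and passes through
  the integral. It reverses the two factors of the integrand, but these commute.\<close>

lemma adj_logm:
  assumes "adj A = A"
  shows "adj (logm A) = logm A"
proof -
  let ?R = "\<lambda>s. sinv (1 + s *\<^sub>R (A - 1))"
  have "adj ((A - 1) * ?R s) = (A - 1) * ?R s" if s: "s \<in> {0..1}" for s
  proof -
    have "adj ((1 + s *\<^sub>R (A - 1)) * ?R s) = 1" by (simp only: segment_sinv[OF s] adj_simps)
    then have "adj (?R s) * (1 + s *\<^sub>R (A - 1)) = 1" by (simp add: assms)
    then have "adj (?R s) * ((1 + s *\<^sub>R (A - 1)) * ?R s) = ?R s"
      by (simp only: mult.assoc[symmetric] mult_1)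
    then have "adj (?R s) = ?R s" by (simp only: segment_sinv[OF s] mult_1_right)
    moreover have "(A - 1) * ?R s = ?R s * (A - 1)"
      by (rule segment_inverse_commute[OF segment_sinv s refl])
    ultimately show ?thesis by (simp add: assms)
  qed
  then have "integral {0..1} (\<lambda>s. adj ((A - 1) * ?R s)) = logm A"
    unfolding logm_def by (intro integral_cong)
  moreover have "integral {0..1} (\<lambda>s. adj ((A - 1) * ?R s)) = adj (logm A)"
    using integral_linear[OF segment_integrand_integrable[OF segment_sinv order_refl] bounded_linear_adj]
    by (simp add: o_def logm_def)
  ultimately show ?thesis by simp
qed

text \<open>This positivity is what later excludes an odd-dimensional eigenspace of -1.\<close>

lemma segment_invertible_sdet_pos: "0 < sdet A"
  using sdet_exp_pos[of "logm A"] by (simp add: exp_logm)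

end

text \<open>Pairing a kernel vector \<open>v\<close> with its image writes 0 as a convex combination
  of the squared norms of \<open>v\<close> and \<open>app A v\<close>, so one of the two vectors
  vanishes.\<close>

lemma segment_invertible_adj_mult_self:
  assumes "sdet A \<noteq> 0"
  shows "segment_invertible (adj A * A)"
  unfolding segment_invertible_def
proof (intro ballI sdet_nonzeroI)
  fix s :: real and v assume s: "s \<in> {0..1}" and v: "app (1 + s *\<^sub>R (adj A * A - 1)) v = 0"
  have "app (adj A * A) v \<bullet> v = app A v \<bullet> app A v"
    using inner_app_adj[of A "app A v" v] by simp
  then have "(1 - s) * (v \<bullet> v) + s * (app A v \<bullet> app A v) = app (1 + s *\<^sub>R (adj A * A - 1)) v \<bullet> v"
    by (simp add: algebra_simps inner_add_left inner_diff_left)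
  also have "\<dots> = 0" by (simp only: v inner_zero_left)
  finally have sum: "(1 - s) * (v \<bullet> v) + s * (app A v \<bullet> app A v) = 0" .
  then have "(1 - s) * (v \<bullet> v) = 0 \<and> s * (app A v \<bullet> app A v) = 0"
    using s by (subst (asm) add_nonneg_eq_0_iff) auto
  then have "v = 0 \<or> app A v = 0" by auto
  moreover have "v = app (sinv A * A) v" using sinv_mult[OF assms] by simp
  ultimately show "v = 0" by auto
qed

text \<open>With \<open>Y\<close> half the logarithm of \<open>adj A * A\<close>,
  \<open>exp Y\<close> is a symmetric square root of \<open>adj A * A\<close>, and
  \<open>A * exp (- Y)\<close> is orthogonal.\<close>

lemma polar_decomposition:
  assumes "sdet A \<noteq> 0"
  obtains Q Y where "A = Q * exp Y" "adj Q * Q = 1"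
proof -
  define G where "G = adj A * A"
  define Y where "Y = (1/2) *\<^sub>R logm G"
  have G: "segment_invertible G" unfolding G_def by (rule segment_invertible_adj_mult_self[OF assms])
  have "adj Y = Y" using adj_logm[OF G] by (simp add: Y_def G_def)
  have GY: "G = exp Y * exp Y"
    by (subst exp_add_commuting[symmetric]) (simp_all add: Y_def exp_logm[OF G] flip: scaleR_add_left)
  have inv: "exp (- Y) * exp Y = 1" "exp Y * exp (- Y) = 1"
    using exp_minus_inverse[of Y] exp_minus_inverse[of "- Y"] by simp_all
  have "adj (A * exp (- Y)) * (A * exp (- Y)) = exp (- Y) * (G * exp (- Y))"
    by (simp add: adj_exp \<open>adj Y = Y\<close> G_def mult.assoc)
  also have "\<dots> = (exp (- Y) * exp Y) * (exp Y * exp (- Y))"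
    by (simp only: GY mult.assoc)
  finally have "adj (A * exp (- Y)) * (A * exp (- Y)) = 1" using inv by simp
  moreover have "A = (A * exp (- Y)) * exp Y" using inv by (simp add: mult.assoc)
  ultimately show thesis using that by blast
qed

text \<open>A kernel vector satisfies \<open>s *\<^sub>R app Q v = (s - 1) *\<^sub>R v\<close>. As
  \<open>Q\<close> preserves norms, \<open>v \<noteq> 0\<close> forces \<open>s = 1/2\<close>, and
  then \<open>v\<close> is an eigenvector for -1.\<close>

lemma segment_invertible_orthogonal:
  assumes Q: "adj Q * Q = 1" and "\<And>v. app Q v = - v \<Longrightarrow> v = 0"
  shows "segment_invertible Q"
  unfolding segment_invertible_def
proof (intro ballI sdet_nonzeroI)
  fix s :: real and v assume s: "s \<in> {0..1}" and v: "app (1 + s *\<^sub>R (Q - 1)) v = 0"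
  have "app Q v \<bullet> app Q v = app (adj Q * Q) v \<bullet> v"
    using inner_app_adj[of Q "app Q v" v] by simp
  then have "norm (app Q v) = norm v" using Q by (simp add: norm_eq)
  have eq: "s *\<^sub>R app Q v = (s - 1) *\<^sub>R v"
    using v by (simp add: algebra_simps)
  then have "norm (s *\<^sub>R app Q v) = norm ((s - 1) *\<^sub>R v)" by simp
  then have "s * norm v = (1 - s) * norm v" using s \<open>norm (app Q v) = norm v\<close> by simp
  then have "v = 0 \<or> s = 1/2" by auto
  then show "v = 0"
  proof
    assume "s = 1/2"
    with eq have "(1/2) *\<^sub>R app Q v = (1/2) *\<^sub>R (- v)" by simp
    then show ?thesis using assms(2) by (subst (asm) scaleR_cancel_left) auto
  qed
qed

section \<open>Products of two exponentials\<close>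

definition outer :: "real^'n::finite \<Rightarrow> real^'n \<Rightarrow> 'n sqmat" where
  "outer u v = of_mat (\<chi> i j. u $ i * v $ j)"

lemma app_outer [simp]: "app (outer u v) x = (v \<bullet> x) *\<^sub>R u"
  by (simp add: app_def outer_def matrix_vector_mult_def vec_eq_iff inner_vec_def
      sum_distrib_left mult_ac)

lemma adj_outer [simp]: "adj (outer u v) = outer v u"
  by (simp add: adj_def outer_def transpose_def mult.commute)

lemma mult_outer: "A * outer u v = outer (app A u) v"
  by (rule sqmat_eqI) simp

lemma outer_mult: "outer u v * A = outer u (app (adj A) v)"
  by (rule sqmat_eqI) (simp add: inner_app_adj)

lemma outer_mult_outer: "outer u v * outer w z = (v \<bullet> w) *\<^sub>R outer u z"
  by (rule sqmat_eqI) simp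

lemma outer_minus [simp]: "outer (- u) v = - outer u v"
  by (rule sqmat_eqI) simp

text \<open>An orthogonal matrix carrying a coordinate axis to \<open>v\<close> conjugates the
  reflection to a diagonal matrix with a single entry -1.\<close>

lemma sdet_reflection:
  fixes v :: "real^'n::finite"
  assumes "norm v = 1"
  shows "sdet (1 - 2 *\<^sub>R outer v v) = -1"
proof -
  fix k :: 'n
  obtain M :: "real^'n^'n" where "orthogonal_matrix M" and M: "M *v axis k 1 = v"
    using orthogonal_matrix_exists_basis[OF assms] .
  define Q where "Q = of_mat M"
  define e :: "real^'n" where "e = axis k 1"
  have Q: "Q * adj Q = 1"
    using \<open>orthogonal_matrix M\<close> by (simp add: Q_def sqmat_eq_iff orthogonal_matrix_def adj_def)
  have v: "v = app Q e" by (simp add: Q_def e_def app_def M)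
  have "Q * outer e e * adj Q = outer v v"
    by (simp add: v mult_outer outer_mult)
  then have "1 - 2 *\<^sub>R outer v v = Q * (1 - 2 *\<^sub>R outer e e) * adj Q"
    using Q by (simp add: algebra_simps)
  then have "sdet (1 - 2 *\<^sub>R outer v v) = sdet (1 - 2 *\<^sub>R outer e e) * (sdet Q * sdet (adj Q))"
    by simp
  also have "sdet Q * sdet (adj Q) = 1" using Q by (metis sdet_mult sdet_1)
  also have "sdet (1 - 2 *\<^sub>R outer e e) = (\<Prod>i\<in>UNIV. mat_of (1 - 2 *\<^sub>R outer e e) $ i $ i)"
    unfolding sdet_def by (rule det_diagonal) (auto simp: outer_def e_def axis_def mat_def)
  also have "\<dots> = (\<Prod>i\<in>UNIV. if i = k then -1 else 1)"
    by (intro prod.cong) (auto simp: outer_def e_def axis_def mat_def)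
  finally show ?thesis by (simp add: prod.delta)
qed

text \<open>Group the orthonormal vectors into pairs \<open>u\<close>, \<open>v\<close> and sum the
  rotations \<open>outer u v - outer v u\<close> by a right angle in their planes. Then
  \<open>- J * J\<close> is the projection onto the span of \<open>F\<close>. Each induction step
  adds one plane, orthogonal to the earlier ones.\<close>

lemma quarter_turn_exists:
  fixes F :: "(real^'n::finite) set"
  assumes "finite F" "card F = 2 * m" "pairwise orthogonal F" "\<And>b. b \<in> F \<Longrightarrow> norm b = 1"
  shows "\<exists>J. adj J = - J \<and> J * J = - (\<Sum>b\<in>F. outer b b) \<and> J * J * J = - J"
  using assms
proof (induction m arbitrary: F)
  case 0
  then show ?case by (intro exI[of _ 0]) simp
next
  case (Suc m)
  then obtain u F1 where F1: "F = insert u F1" "u \<notin> F1" "card F1 = Suc (2 * m)"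
    by (auto simp: card_Suc_eq)
  then obtain v F2 where F2: "F1 = insert v F2" "v \<notin> F2" "card F2 = 2 * m"
    by (auto simp: card_Suc_eq)
  have fin: "finite F2" using Suc.prems(1) F1 F2 by simp
  let ?P = "\<Sum>b\<in>F2. outer b b"
  have orth: "a \<bullet> b = 0" if "a \<in> F" "b \<in> F" "a \<noteq> b" for a b
    using Suc.prems(3) that by (auto simp: pairwise_def orthogonal_def)
  have unit: "a \<bullet> a = 1" if "a \<in> F" for a
    using Suc.prems(4)[OF that] by (simp add: norm_eq_1)
  obtain J where J: "adj J = - J" "J * J = - ?P" "J * J * J = - J"
    using Suc.IH[OF fin F2(3)] Suc.prems(3,4) F1 F2 by (auto simp: pairwise_def)
  have Pker: "?P * outer a b = 0" if "a \<in> {u, v}" for a b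
  proof -
    have "?P * outer a b = (\<Sum>c\<in>F2. (c \<bullet> a) *\<^sub>R outer c b)"
      by (simp add: sum_distrib_right outer_mult_outer)
    also have "\<dots> = 0" using that F1 F2 by (intro sum.neutral) (auto intro!: orth)
    finally show ?thesis .
  qed
  have Jker: "J * outer a b = 0" if "a \<in> {u, v}" for a b
  proof -
    \<comment> \<open>Since \<open>J = - J * (J * J)\<close> and \<open>J * J = - ?P\<close>,
      whatever \<open>?P\<close> annihilates is annihilated by \<open>J\<close>.\<close>
    have "J * outer a b = - (J * (J * J) * outer a b)" using J(3) by (simp add: mult.assoc)
    also have "\<dots> = J * (?P * outer a b)" by (simp add: J(2) mult.assoc)
    finally show ?thesis using Pker[OF that] by simp
  qed
  have kerJ: "outer b a * J = 0" if "a \<in> {u, v}" for a b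
  proof -
    have "adj (J * outer a b) = 0" using Jker[OF that] by simp
    then show ?thesis by (simp add: J(1))
  qed
  have uv: "u \<bullet> v = 0" "v \<bullet> u = 0" "u \<bullet> u = 1" "v \<bullet> v = 1"
    using F1 F2 by (auto intro!: orth unit)
  let ?K = "outer u v - outer v u"
  let ?p = "outer u u + outer v v"
  have JK: "J * ?K = 0" "?K * J = 0" "J * ?p = 0" by (simp_all add: algebra_simps Jker kerJ)
  have KK: "?K * ?K = - ?p" by (simp add: algebra_simps outer_mult_outer uv)
  have Kp: "?K * ?p = ?K" by (simp add: algebra_simps outer_mult_outer uv)
  have sq: "(J + ?K) * (J + ?K) = J * J - ?p"
    by (simp only: distrib_left distrib_right JK KK) simp
  have "(J + ?K) * ((J + ?K) * (J + ?K)) = J * (J * J) - J * ?p + ?K * J * J - ?K * ?p"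
    unfolding sq by (simp only: distrib_left distrib_right right_diff_distrib mult.assoc) (simp only: algebra_simps)
  also have "\<dots> = - (J + ?K)" using J(3) by (simp only: JK Kp mult.assoc) simp
  finally have cube: "(J + ?K) * (J + ?K) * (J + ?K) = - (J + ?K)" by (simp only: mult.assoc)
  have "(\<Sum>b\<in>F. outer b b) = ?p + ?P"
    using F1 F2 fin by (simp add: add.assoc)
  then have "(J + ?K) * (J + ?K) = - (\<Sum>b\<in>F. outer b b)" unfolding sq by (simp add: J(2))
  moreover have "adj (J + ?K) = - (J + ?K)" using J(1) by simp
  ultimately show ?case using cube by blast
qed

text \<open>On the range of \<open>- J * J\<close> the matrix \<open>R\<close> below is a quarter turn, on the range of \<open>q\<close>
  it is \<open>- 1\<close>, and elsewhere it is the identity.  Removing it from \<open>Q\<close> kills the eigenvalue \<open>- 1\<close>.\<close>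

context
  fixes J q R :: "'n::finite sqmat"
  assumes J: "adj J = - J" "J * J * J = - J"
    and q: "adj q = q" "q * q = q" "J * q = 0"
  defines "R \<equiv> 1 + J + J * J - 2 *\<^sub>R q"
begin

lemma qJ: "q * J = 0"
proof -
  have "adj (J * q) = 0" by (simp add: q)
  then show ?thesis by (simp add: J(1) q(1))
qed

text \<open>With \<open>a = 1 + J * J - 2 *\<^sub>R q\<close>, which commutes with \<open>J\<close>,
  the product is \<open>(a - J) * (a + J) = a * a - J * J\<close>; the cubic relation for
  \<open>J\<close> reduces this to 1.\<close>

lemma quarter_turn_orthogonal: "adj R * R = 1"
proof -
  have "q * (J * X) = 0" "J * (q * X) = 0" "J * (J * (J * X)) = - (J * X)" "q * (q * X) = q * X" for X
    using qJ q J by (simp_all flip: mult.assoc)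
  moreover have "J * (J * J) = - J" using J(2) by (simp only: mult.assoc)
  ultimately show ?thesis by (simp add: R_def J q qJ algebra_simps) (simp flip: scaleR_add_left)
qed

text \<open>The eigenvector equation reads \<open>J J x + J x + 2 x = 0\<close>. Applying
  \<open>J\<close> and using \<open>J J J = - J\<close> gives \<open>J J x + J x = 0\<close>, so
  \<open>2 x = 0\<close>.\<close>

lemma quarter_turn_no_eigenvector:
  assumes "q = 0" "app R x = - x"
  shows "x = 0"
proof -
  have J3: "app J (app J (app J y)) = - app J y" for y
    using J(2) by (metis app_simps(5) app_minus)
  have eq: "app J (app J x) + app J x + 2 *\<^sub>R x = 0"
    using assms by (simp add: R_def algebra_simps scaleR_2)
  have "- app J x + app J (app J x) + 2 *\<^sub>R app J x = 0"
    using arg_cong[OF eq, of "app J"] by (simp add: J3)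
  then have e1: "app J x + app J (app J x) = 0" by (simp add: vec_eq_iff algebra_simps)
  with eq have "2 *\<^sub>R x = 0" by (simp add: add.commute scaleR_2)
  then show ?thesis by simp
qed

lemma quarter_turn_segment_invertible: "q = 0 \<Longrightarrow> segment_invertible R"
  using segment_invertible_orthogonal[OF quarter_turn_orthogonal quarter_turn_no_eigenvector] .

text \<open>Here \<open>q - J * J\<close> is the projection onto the whole eigenspace of -1:
  \<open>Q\<close> negates its range, and by \<open>span\<close> it fixes every eigenvector for
  -1.\<close>

context
  fixes Q :: "'n sqmat"
  assumes Q: "adj Q * Q = 1" "Q * J = - J" "Q * q = - q"
    and span: "\<And>y. app Q y = - y \<Longrightarrow> app q y - app J (app J y) = y"
begin

text \<open>Transpose the relations for \<open>Q * J\<close> and \<open>Q * q\<close>, then multiply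
  by \<open>Q\<close> on the right.\<close>

lemma JQ: "J * Q = - J" and qQ: "q * Q = - q"
proof -
  have "adj (Q * J) = adj (- J)" "adj (Q * q) = adj (- q)" by (simp_all only: Q)
  then have "J * adj Q = - J" "q * adj Q = - q" by (simp_all add: J q) (metis minus_minus)
  then have "J * (adj Q * Q) = - J * Q" "q * (adj Q * Q) = - q * Q" by (simp_all flip: mult.assoc)
  then show "J * Q = - J" "q * Q = - q" by (simp_all add: Q) (metis minus_minus)+
qed

lemma quarter_turn_commute: "Q * R = R * Q"
proof -
  have "J * J * Q = - (J * J)" by (simp add: mult.assoc JQ)
  moreover have "Q * (J * J) = - (J * J)" by (simp add: Q flip: mult.assoc)
  ultimately show ?thesis by (simp add: R_def algebra_simps Q qQ JQ)
qed

lemma quotient_orthogonal: "adj (Q * adj R) * (Q * adj R) = 1"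
proof -
  have "adj (Q * adj R) * (Q * adj R) = R * ((adj Q * Q) * adj R)" by (simp only: adj_simps mult.assoc)
  then show ?thesis using quarter_turn_orthogonal by (simp add: Q(1) sqmat_left_right_inverse)
qed

text \<open>For \<open>y = app (adj R) x\<close> the equation becomes \<open>Q y = - R y\<close>.
  Applying \<open>q\<close> gives \<open>q y = 0\<close>; applying \<open>J\<close> gives
  \<open>J J y = J y\<close>, hence \<open>J y = 0\<close> by the cubic relation. Then
  \<open>R y = y\<close>, so \<open>y\<close> lies in the eigenspace of -1, and \<open>span\<close>
  makes it zero.\<close>

lemma quotient_no_eigenvector:
  assumes x: "app (Q * adj R) x = - x"
  shows "x = 0"
proof -
  define y where "y = app (adj R) x"
  have "app (R * adj R) x = x" using quarter_turn_orthogonal by (simp add: sqmat_left_right_inverse)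
  then have xy: "x = app R y" by (simp add: y_def)
  have "app Q y = - x" using x by (simp add: y_def)
  then have Qy: "app Q y = - app R y" by (subst (asm) xy)
  have neg: "z = 0" if "z = - z" for z :: "real^'n"
    using that by (simp add: vec_eq_iff)
  have ap: "app J (app Q z) = - app J z" "app q (app Q z) = - app q z"
      "app J (app J (app J z)) = - app J z" "app J (app q z) = 0" "app q (app J z) = 0" "app q (app q z) = app q z" for z
    using arg_cong[OF JQ, of "\<lambda>M. app M z"] arg_cong[OF qQ, of "\<lambda>M. app M z"]
      arg_cong[OF J(2), of "\<lambda>M. app M z"] arg_cong[OF q(2), of "\<lambda>M. app M z"]
      arg_cong[OF q(3), of "\<lambda>M. app M z"] arg_cong[OF qJ, of "\<lambda>M. app M z"] by simp_all
  from arg_cong[OF Qy, of "app q"] have qy: "app q y = 0"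
    by (simp add: R_def ap)
  from arg_cong[OF Qy, of "app J"] have a: "app J (app J y) = app J y"
    by (simp add: R_def ap qy)
  have "- app J y = app J (app J (app J y))" by (simp only: ap)
  also have "\<dots> = app J y" by (simp only: a)
  finally have Jy: "app J y = 0" by (intro neg) (rule sym)
  have "app Q y = - y" using Qy by (simp add: R_def qy Jy)
  from span[OF this] have "y = 0" by (simp add: qy Jy)
  then show ?thesis using xy by simp
qed

lemma quotient_segment_invertible: "segment_invertible (Q * adj R)"
  using segment_invertible_orthogonal[OF quotient_orthogonal quotient_no_eigenvector] .

end
end

text \<open>Commutation passes from the matrices to their logarithms, one factor at a time, so the
  exponential of the sum is the product.\<close>

lemma exp_commuting_product:
  assumes "segment_invertible A" "segment_invertible B" "A * B = B * A"
  shows "\<exists>X. exp X = A * B"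
proof
  have "logm A * B = B * logm A" using logm_commute[OF assms(1), of B] assms(3) by simp
  then have "logm A * logm B = logm B * logm A" by (rule logm_commute[OF assms(2)])
  then show "exp (logm A + logm B) = A * B"
    by (simp add: exp_add_commuting exp_logm assms)
qed

text \<open>If the eigenspace \<open>V\<close> of -1 has even dimension, pairing an orthonormal
  basis gives a quarter turn \<open>R\<close> of \<open>V\<close>, and
  \<open>Q = (Q * adj R) * R\<close> with commuting factors free of the eigenvalue -1. Odd dimension
  contradicts the sign of the determinant.\<close>

lemma special_orthogonal_is_exp:
  fixes Q :: "'n::finite sqmat"
  assumes Q: "adj Q * Q = 1" and det: "0 < sdet Q"
  shows "\<exists>X. exp X = Q"
proof -
  define V where "V = {v. app Q v = - v}"
  have "subspace V" by (auto simp: V_def subspace_def)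
  then obtain B where B: "B \<subseteq> V" "pairwise orthogonal B" "\<And>b. b \<in> B \<Longrightarrow> norm b = 1"
      "independent B" "span B = V"
    by (rule orthonormal_basis_subspace) blast
  have fin: "finite B" using B(4) by (rule independent_imp_finite)
  have orth: "a \<bullet> b = (if a = b then 1 else 0)" if "a \<in> B" "b \<in> B" for a b
    using B(2,3) that by (auto simp: pairwise_def orthogonal_def norm_eq_1)
  have expand: "(\<Sum>b\<in>B. app (outer b b) y) = y" if "app Q y = - y" for y
  proof -
    have "y \<in> span B" using that B(5) by (simp add: V_def)
    from orthonormal_basis_expand[OF B(2,3) this fin] show ?thesis by (simp add: inner_commute)
  qed
  have app_sum: "app (\<Sum>b\<in>F. M b) y = (\<Sum>b\<in>F. app (M b) y)" for F and M :: "real^'n \<Rightarrow> 'n sqmat" and y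
    by (induction F rule: infinite_finite_induct) simp_all
  \<comment> \<open>\<open>Q\<close> negates the span of \<open>F\<close>, hence the range of
    \<open>J * J\<close>; by \<open>J * J * J = - J\<close> the range of \<open>J\<close> lies there
    too.\<close>
  have QJ: "Q * J = - J" if "J * J = - (\<Sum>b\<in>F. outer b b)" "J * J * J = - J" "F \<subseteq> B" for F J
  proof -
    have "Q * (\<Sum>b\<in>F. outer b b) = (\<Sum>b\<in>F. - outer b b)"
      unfolding sum_distrib_left using that(3) B(1)
      by (intro sum.cong) (auto simp: mult_outer V_def)
    then have "Q * (J * J) = - (J * J)" by (simp add: that(1) sum_negf)
    then have "Q * (J * J * J) = - (J * J * J)" by (simp flip: mult.assoc)
    then have "- (Q * J) = J" by (simp add: that(2))
    then show ?thesis by (metis minus_minus)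
  qed
  have part: "\<exists>J. adj J = - J \<and> J * J = - (\<Sum>b\<in>F. outer b b) \<and> J * J * J = - J"
      if "F \<subseteq> B" "card F = 2 * m" for F m
  proof (rule quarter_turn_exists)
    show "finite F" using that(1) fin by (rule finite_subset)
    show "pairwise orthogonal F" using B(2) that(1) by (rule pairwise_subset)
  qed (use that B(3) in auto)
  show ?thesis
  proof (cases "even (card B)")
    case True
    then obtain m where "card B = 2 * m" by blast
    with part obtain J where J: "adj J = - J" "J * J = - (\<Sum>b\<in>B. outer b b)" "J * J * J = - J"
      by blast
    \<comment> \<open>The term \<open>2 *\<^sub>R 0\<close> keeps the shape required by the general
      lemmas, taken with \<open>q = 0\<close>: no basis vector is left unpaired.\<close>
    define R where "R = 1 + J + J * J - 2 *\<^sub>R 0"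
    have sp: "app 0 y - app J (app J y) = y" if "app Q y = - y" for y
    proof -
      have "- app J (app J y) = app (- (J * J)) y" by simp
      also have "\<dots> = y" using expand[OF that] by (simp only: J(2) minus_minus app_sum)
      finally show ?thesis by simp
    qed
    have q: "adj 0 = (0 :: 'n sqmat)" "0 * 0 = (0 :: 'n sqmat)" "J * 0 = 0" "Q * 0 = - 0" by simp_all
    note lem = J(1,3) q(1-3) Q QJ[OF J(2,3) order_refl] q(4) sp
    have R: "segment_invertible R" "adj R * R = 1"
      unfolding R_def by (rule quarter_turn_segment_invertible[OF J(1,3) q(1-3) refl],
        rule quarter_turn_orthogonal[OF J(1,3) q(1-3)])
    have S: "segment_invertible (Q * adj R)"
      unfolding R_def by (rule quotient_segment_invertible[OF lem])
    have QR: "Q * R = R * Q" unfolding R_def by (rule quarter_turn_commute[OF lem])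
    have "Q * adj R * R = Q" using R(2) by (simp add: mult.assoc)
    moreover have "R * (Q * adj R) = Q"
    proof -
      have "R * (Q * adj R) = Q * (R * adj R)" by (simp add: QR flip: mult.assoc)
      then show ?thesis using R(2) by (simp add: sqmat_left_right_inverse)
    qed
    ultimately show ?thesis using exp_commuting_product[OF S R(1)] by simp
  next
    case False
    \<comment> \<open>Impossible: \<open>Q\<close> would be a reflection times factors of positive determinant.\<close>
    then obtain m where "card B = Suc (2 * m)" by (auto elim!: oddE)
    then obtain b F where F: "B = insert b F" "b \<notin> F" "card F = 2 * m"
      by (auto simp: card_Suc_eq)
    with part[of F m] obtain J where J: "adj J = - J" "J * J = - (\<Sum>b\<in>F. outer b b)" "J * J * J = - J"
      by blast
    have finF: "finite F" using fin F by simp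
    let ?q = "outer b b"
    \<comment> \<open>\<open>R'\<close> negates the unpaired vector \<open>b\<close>, whereas
      \<open>R\<close> fixes it.\<close>
    define R R' where "R = 1 + J + J * J - 2 *\<^sub>R 0" and "R' = 1 + J + J * J - 2 *\<^sub>R ?q"
    have "J * J * ?q = 0"
    proof -
      have "(\<Sum>b\<in>F. outer b b) * ?q = (\<Sum>c\<in>F. (c \<bullet> b) *\<^sub>R outer c b)"
        by (simp add: sum_distrib_right outer_mult_outer)
      also have "\<dots> = 0" using F orth by (intro sum.neutral) auto
      finally show ?thesis by (simp add: J(2))
    qed
    then have "J * (J * J * ?q) = 0" by simp
    then have "J * J * J * ?q = 0" by (simp add: mult.assoc)
    then have Jq: "J * ?q = 0" by (simp add: J(3))
    have q: "adj ?q = ?q" "?q * ?q = ?q" "J * ?q = 0" "Q * ?q = - ?q"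
      using Jq orth[of b b] F B(1) by (auto simp: outer_mult_outer mult_outer V_def)
    have sp: "app ?q y - app J (app J y) = y" if "app Q y = - y" for y
    proof -
      have "app ?q y - app J (app J y) = app ?q y + app (- (J * J)) y" by simp
      also have "\<dots> = app ?q y + (\<Sum>b\<in>F. app (outer b b) y)" by (simp only: J(2) minus_minus app_sum)
      also have "\<dots> = y" using expand[OF that] F(1,2) finF by simp
      finally show ?thesis .
    qed
    have "F \<subseteq> B" using F by auto
    note lem = J(1,3) q(1-3) Q QJ[OF J(2,3) \<open>F \<subseteq> B\<close>] q(4) sp
    have "0 < sdet (Q * adj R')"
      unfolding R'_def by (rule segment_invertible_sdet_pos[OF quotient_segment_invertible[OF lem]])
    \<comment> \<open>\<open>Q\<close> and \<open>Q * adj R'\<close> have positive determinant, and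
      transposing \<open>R'\<close> preserves its determinant.\<close>
    then have R'pos: "0 < sdet R'" using det by (simp add: zero_less_mult_iff)
    have q0: "adj 0 = (0 :: 'n sqmat)" "0 * 0 = (0 :: 'n sqmat)" "J * 0 = 0" by simp_all
    have "segment_invertible R"
      unfolding R_def by (rule quarter_turn_segment_invertible[OF J(1,3) q0 refl])
    then have "0 < sdet R" by (rule segment_invertible_sdet_pos)
    \<comment> \<open>\<open>J\<close> annihilates \<open>b\<close>, so \<open>R'\<close> is
      \<open>R\<close> times a reflection; its determinant would also be negative.\<close>
    moreover have "R' = R * (1 - 2 *\<^sub>R ?q)"
      using Jq \<open>J * J * ?q = 0\<close> by (simp add: R_def R'_def algebra_simps)
    moreover have "sdet (1 - 2 *\<^sub>R ?q) = - 1" using B(3) F by (intro sdet_reflection) auto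
    ultimately show ?thesis using R'pos by simp
  qed
qed

lemma product_of_two_exps:
  assumes "0 < sdet A"
  obtains X Y where "A = exp X * exp Y"
proof -
  have "sdet A \<noteq> 0" using assms by simp
  then obtain Q Y where QY: "A = Q * exp Y" "adj Q * Q = 1"
    by (rule polar_decomposition)
  then have "0 < sdet Q" using assms sdet_exp_pos[of Y] by (simp add: zero_less_mult_iff)
  with special_orthogonal_is_exp[OF QY(2)] QY(1) that show thesis by blast
qed

section \<open>The geodesics of the metric\<close>

lemma tendsto_sdet: "(sdet \<longlongrightarrow> sdet p) (at p)"
  unfolding sdet_def[abs_def] det_def
  by (intro tendsto_intros bounded_linear.tendsto[OF bounded_linear_mat_of])

lemma has_derivative_sinv:
  fixes p :: "'n::finite sqmat"
  assumes "sdet p \<noteq> 0"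
  shows "(sinv has_derivative (\<lambda>h. - (sinv p * h * sinv p))) (at p)"
proof (rule has_derivative_algebra_inverse)
  have "\<forall>\<^sub>F q in at p. sdet q \<noteq> 0"
    using tendsto_sdet assms by (rule tendsto_imp_eventually_ne)
  then show "\<forall>\<^sub>F q in at p. sinv q * q = 1"
    by eventually_elim (rule sinv_mult)
qed (rule sinv_mult[OF assms])

section \<open>The trace form and its Levi-Civita connection\<close>

definition strace :: "'n::finite sqmat \<Rightarrow> real" where
  "strace A = trace (mat_of A)"

lemma strace_commute: "strace (A * B) = strace (B * A)"
  unfolding strace_def mat_of_simps by (rule trace_mul_sym)

lemma bounded_linear_strace: "bounded_linear strace"
proof -
  have "linear (trace :: real^'n^'n \<Rightarrow> real)"
    by (intro linearI) (simp_all add: trace_def sum.distrib sum_distrib_left)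
  then have "bounded_linear (trace :: real^'n^'n \<Rightarrow> real)"
    by (simp add: linear_conv_bounded_linear)
  from bounded_linear_compose[OF this bounded_linear_mat_of] show ?thesis
    by (simp add: strace_def[abs_def])
qed

lemmas strace_linear = linear_simps[OF bounded_linear_strace]

text \<open>The trace is the sum of the squares of the entries; this yields nondegeneracy of the
  metric.\<close>

lemma strace_mult_adj_eq_0:
  assumes "strace (A * adj A) = 0"
  shows "A = 0"
proof -
  have "strace (A * adj A) = (\<Sum>i\<in>UNIV. \<Sum>j\<in>UNIV. (mat_of A $ i $ j)\<^sup>2)"
    by (simp add: strace_def trace_def adj_def matrix_matrix_mult_def transpose_def power2_eq_square)
  with assms have "mat_of A $ i $ j = 0" for i j
    by (simp add: sum_nonneg_eq_0_iff sum_nonneg)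
  then show ?thesis by (simp add: sqmat_eq_iff vec_eq_iff)
qed

lemma GL_metric_sqmat:
  "GL_metric (mat_of P) (mat_of V) (mat_of W) = strace (sinv P * V * sinv P * W)"
  by (simp add: GL_metric_def strace_def sinv_def)

text \<open>Inversion is differentiated in the algebra and transported along \<open>of_mat\<close>;
  the two inverses in the metric yield the two terms.\<close>

lemma GL_metric_has_derivative:
  fixes P V W :: "'n::finite sqmat"
  assumes "sdet P \<noteq> 0"
  shows "((\<lambda>q. GL_metric q (mat_of V) (mat_of W)) has_derivative
    (\<lambda>h. - strace (sinv P * V * sinv P * of_mat h * sinv P * W)
         - strace (sinv P * of_mat h * sinv P * V * sinv P * W))) (at (mat_of P))"
proof -
  have 1: "((\<lambda>q. sinv (of_mat q)) has_derivative (\<lambda>h. - (sinv P * of_mat h * sinv P))) (at (mat_of P))"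
    using has_derivative_compose[OF bounded_linear_imp_has_derivative[OF bounded_linear_of_mat]
      has_derivative_sinv, of "mat_of P"] assms by simp
  have "((\<lambda>q. strace (sinv (of_mat q) * V * sinv (of_mat q) * W)) has_derivative
    (\<lambda>h. strace ((sinv P * V * - (sinv P * of_mat h * sinv P) + - (sinv P * of_mat h * sinv P) * V * sinv P) * W)))
     (at (mat_of P))"
    by (rule bounded_linear.has_derivative[OF bounded_linear_strace])
       (auto intro!: derivative_eq_intros 1)
  moreover have "GL_metric q (mat_of V) (mat_of W) = strace (sinv (of_mat q) * V * sinv (of_mat q) * W)" for q
    using GL_metric_sqmat[of "of_mat q"] by simp
  ultimately show ?thesis
    by (simp add: algebra_simps strace_linear)
qed

lemma frechet_derivative_GL_metric:
  assumes "sdet P \<noteq> 0"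
  shows "frechet_derivative (\<lambda>q. GL_metric q (mat_of V) (mat_of W)) (at (mat_of P)) (mat_of H)
    = - strace (sinv P * V * sinv P * H * sinv P * W) - strace (sinv P * H * sinv P * V * sinv P * W)"
  by (subst frechet_derivative_at[OF GL_metric_has_derivative[OF assms, of V W], symmetric]) simp

lemma christoffel_GL_metric:
  fixes P V :: "'n::finite sqmat"
  assumes "sdet P \<noteq> 0"
  shows "christoffel GL_metric (mat_of P) (mat_of V) (mat_of V) = - mat_of (V * sinv P * V)"
proof -
  let ?I = "sinv P"
  have first: "christoffel_first GL_metric (mat_of P) (mat_of V) (mat_of V) (mat_of Z)
      = - strace (?I * V * ?I * V * ?I * Z)" for Z
  proof -
    \<comment> \<open>By cyclicity all six traces in the Koszul formula agree. Each derivative is -2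
      times that trace, and the signs +, +, - with the division by 2 leave -1 times it.\<close>
    have "strace (?I * Z * ?I * V * ?I * V) = strace (?I * V * ?I * V * ?I * Z)"
      "strace (?I * V * ?I * Z * ?I * V) = strace (?I * V * ?I * V * ?I * Z)"
      using strace_commute[of "?I * Z" "?I * V * ?I * V"] strace_commute[of "?I * V * ?I * Z" "?I * V"]
      by (simp_all add: mult.assoc)
    then show ?thesis
      unfolding christoffel_first_def frechet_derivative_GL_metric[OF assms] by simp
  qed
  show ?thesis
    unfolding christoffel_def
  proof (rule the_equality)
    show "\<forall>z. GL_metric (mat_of P) (- mat_of (V * sinv P * V)) z
      = christoffel_first GL_metric (mat_of P) (mat_of V) (mat_of V) z"
    proof
      fix z
      show "GL_metric (mat_of P) (- mat_of (V * sinv P * V)) z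
        = christoffel_first GL_metric (mat_of P) (mat_of V) (mat_of V) z"
        using first[of "of_mat z"] GL_metric_sqmat[of P "- (V * sinv P * V)" "of_mat z"]
        by (simp add: strace_linear mult.assoc del: mat_of_simps(6))
    qed
  next
    fix u assume u: "\<forall>z. GL_metric (mat_of P) u z
      = christoffel_first GL_metric (mat_of P) (mat_of V) (mat_of V) z"
    define D where "D = of_mat u + V * ?I * V"
    have "strace (?I * D * ?I * Z) = 0" for Z
    proof -
      have "strace (?I * of_mat u * ?I * Z) = - strace (?I * V * ?I * V * ?I * Z)"
        using u first[of Z] GL_metric_sqmat[of P "of_mat u" Z] by simp
      then show ?thesis by (simp add: D_def algebra_simps strace_linear)
    qed
    \<comment> \<open>This test vector cancels the second inverse and leaves the trace of
      \<open>?I * D\<close> times its transpose, a sum of squares.\<close>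
    from this[of "P * adj (?I * D)"] have "strace ((?I * D) * (?I * P) * adj (?I * D)) = 0"
      by (simp only: mult.assoc)
    then have "?I * D = 0" by (intro strace_mult_adj_eq_0) (simp only: sinv_mult[OF assms] mult_1_right)
    then have "P * ?I * D = 0" by (simp add: mult.assoc)
    then have "D = 0" by (simp add: sinv_mult[OF assms])
    then show "u = - mat_of (V * sinv P * V)"
      by (simp add: D_def sqmat_eq_iff eq_neg_iff_add_eq_0)
  qed
qed

text \<open>At the point \<open>P = K * exp (t *\<^sub>R X)\<close> the velocity is
  \<open>P * X\<close> and the acceleration \<open>P * X ^ 2\<close>, which the Christoffel term
  \<open>- (P * X) * sinv P * (P * X)\<close> cancels.\<close>

lemma one_parameter_geodesic_arc:
  fixes K X :: "'n::finite sqmat"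
  assumes K: "sdet K \<noteq> 0" and M: "\<And>t. mat_of (K * exp (t *\<^sub>R X)) \<in> M"
  shows "geodesic_arc M GL_metric (mat_of K) (mat_of (K * exp X)) (\<lambda>t. mat_of (K * exp (t *\<^sub>R X)))"
proof -
  define D where "D k t = mat_of (K * exp (t *\<^sub>R X) * X ^ k)" for k :: nat and t :: real
  have "(D k has_vector_derivative D (Suc k) t) (at t within {0..1})" for k t
  proof -
    have "((\<lambda>t. K * exp (t *\<^sub>R X) * X ^ k) has_vector_derivative K * (exp (t *\<^sub>R X) * X) * X ^ k) (at t within {0..1})"
      by (intro has_vector_derivative_mult_left has_vector_derivative_mult_right
          exp_scaleR_has_vector_derivative_right)
    from bounded_linear.has_vector_derivative[OF bounded_linear_mat_of this]
    show ?thesis by (simp add: D_def[abs_def] mult.assoc)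
  qed
  moreover have "D 2 t + christoffel GL_metric (D 0 t) (D 1 t) (D 1 t) = 0" for t
  proof -
    let ?P = "K * exp (t *\<^sub>R X)"
    have P: "sdet ?P \<noteq> 0" using K sdet_exp_pos[of "t *\<^sub>R X"] by simp
    have "(?P * X) * sinv ?P * (?P * X) = ?P * X * (sinv ?P * ?P) * X" by (simp only: mult.assoc)
    also have "\<dots> = ?P * X ^ 2" by (simp only: sinv_mult[OF P] power2_eq_square mult_1_right mult.assoc)
    finally show ?thesis using christoffel_GL_metric[OF P, of "?P * X"]
      by (simp only: D_def power_0 power_one_right mult_1_right) simp
  qed
  moreover have "D 0 = (\<lambda>t. mat_of (K * exp (t *\<^sub>R X)))" by (simp add: D_def[abs_def])
  ultimately show ?thesis
    unfolding geodesic_arc_def using M by (intro conjI exI[of _ D]) (auto simp: fun_eq_iff)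
qed

text \<open>The sign conditions treat both components at once. Writing
  \<open>sinv K * L = exp X * exp Y\<close> puts the break at \<open>K * exp X\<close>; exponentials
  have positive determinant, so both arcs keep the sign of \<open>det K1\<close>.\<close>

lemma singly_broken_geodesic_arc_exists:
  fixes K1 K2 :: "real^'n::finite^'n"
  assumes det: "0 < det K1 * det K2" and M: "\<And>A. 0 < det A * det K1 \<Longrightarrow> A \<in> M"
  shows "\<exists>\<gamma>. singly_broken_geodesic_arc M GL_metric K1 K2 \<gamma>"
proof -
  define K L where "K = of_mat K1" and "L = of_mat K2"
  have K: "sdet K \<noteq> 0" and KL: "0 < sdet K * sdet L" using det by (auto simp: K_def L_def sdet_def)
  have "sdet (sinv K) * sdet K = 1" using sinv_mult(1)[OF K] by (metis sdet_mult sdet_1)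
  then have "0 < sdet (sinv K) * sdet L" using KL by (smt (verit) zero_less_mult_iff)
  then obtain X Y where XY: "sinv K * L = exp X * exp Y"
    using product_of_two_exps[of "sinv K * L"] by auto
  have "K * (sinv K * L) = L" using sinv_mult(2)[OF K] by (simp flip: mult.assoc)
  then have L_eq: "L = K * exp X * exp Y" by (simp add: XY mult.assoc)
  have inM: "mat_of A \<in> M" if "0 < sdet A * sdet K" for A
    using M[of "mat_of A"] that by (simp add: sdet_def K_def)
  have KK: "0 < sdet K * sdet K" using K by (simp add: zero_less_mult_iff) linarith
  have s1: "0 < sdet (K * exp Z) * sdet K" for Z
    using KK sdet_exp_pos[of Z] by (simp add: mult_ac) (metis mult_pos_pos mult.assoc mult.commute)
  have "geodesic_arc M GL_metric (mat_of K) (mat_of (K * exp X)) (\<lambda>t. mat_of (K * exp (t *\<^sub>R X)))"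
    by (intro one_parameter_geodesic_arc K inM s1)
  moreover have "sdet (K * exp X) \<noteq> 0" using s1[of X] by auto
  then have "geodesic_arc M GL_metric (mat_of (K * exp X)) (mat_of (K * exp X * exp Y))
      (\<lambda>t. mat_of (K * exp X * exp (t *\<^sub>R Y)))"
  proof (rule one_parameter_geodesic_arc)
    fix t
    have "0 < (sdet (K * exp X) * sdet K) * sdet (exp (t *\<^sub>R Y))"
      using s1 sdet_exp_pos by (rule mult_pos_pos)
    then show "mat_of (K * exp X * exp (t *\<^sub>R Y)) \<in> M" by (intro inM) (simp add: mult_ac)
  qed
  moreover have "mat_of K = K1" "mat_of (K * exp X * exp Y) = K2"
    unfolding L_eq[symmetric] by (simp_all add: K_def L_def)
  ultimately show ?thesis
    unfolding singly_broken_geodesic_arc_def by metis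
qed

theorem proposition2p2:
  fixes K1 K2 :: "real ^ 'n ^ 'n"
  shows "(K1 \<in> GL_pos \<and> K2 \<in> GL_pos \<longrightarrow>
            (\<exists>\<gamma>. singly_broken_geodesic_arc GL_pos GL_metric K1 K2 \<gamma>)) \<and>
         (K1 \<in> GL_neg \<and> K2 \<in> GL_neg \<longrightarrow>
            (\<exists>\<gamma>. singly_broken_geodesic_arc GL_neg GL_metric K1 K2 \<gamma>))"
  by (auto simp: GL_pos_def GL_neg_def zero_less_mult_iff intro!: singly_broken_geodesic_arc_exists)

end
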